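(* Let $\mathcal U$ be an ultrafilter on $[0,1]$ and let $h:[0,1]\to[0,1]$ be a strictly increasing homeomorphism fixing $0$ and $1$. If $S,T:[0,1]^2\to[0,1]$ satisfy $S\sim_{\mathcal U}T$, then $S^h\sim_{h_*\mathcal U}T^h$.
   Context: For an ultrafilter $\mathcal W$ on $[0,1]$ and binary operations $S,T:[0,1]^2\to[0,1]$, write $S\sim_{\mathcal W}T$ if there is $A\in\mathcal W$ with $S(x,y)=T(x,y)$ for all $(x,y)\in A\times A$. The pushforward ultrafilter $h_*\mathcal U$ on $[0,1]$ is defined by $B\in h_*\mathcal U\iff h^{-1}(B)\in\mathcal U$, for $B\subseteq[0,1]$. For a binary operation $T:[0,1]^2\to[0,1]$, its $h$-conjugate is $T^h(a,b):=h\bigl(T(h^{-1}(a),h^{-1}(b))\bigr)$. *)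

theory Defs
  imports "HOL-Analysis.Analysis"
begin

text \<open>
  An ultrafilter on a set \<open>X\<close> is represented by a library filter on the ambient type that is
  concentrated on \<open>X\<close>. The members of the ultrafilter are the sets \<open>A \<subseteq> X\<close> with
  \<open>\<forall>\<^sub>F x in F. x \<in> A\<close>, and this family determines \<open>F\<close>.
\<close>

definition ultrafilter_on :: "'a set \<Rightarrow> 'a filter \<Rightarrow> bool" where
  "ultrafilter_on X F \<longleftrightarrow>
     F \<noteq> bot \<and> F \<le> principal X \<and>
     (\<forall>A\<subseteq>X. (\<forall>\<^sub>F x in F. x \<in> A) \<or> (\<forall>\<^sub>F x in F. x \<in> X - A))"

text \<open>The relation \<open>S \<sim>\<^sub>W T\<close> for an ultrafilter \<open>W\<close> on \<open>[0,1]\<close>.\<close>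

definition sim_mod ::
  "real filter \<Rightarrow> (real \<times> real \<Rightarrow> real) \<Rightarrow> (real \<times> real \<Rightarrow> real) \<Rightarrow> bool" where
  "sim_mod W S T \<longleftrightarrow>
     (\<exists>A\<subseteq>{0..1}. (\<forall>\<^sub>F x in W. x \<in> A) \<and> (\<forall>(x, y) \<in> A \<times> A. S (x, y) = T (x, y)))"

definition conjugate ::
  "(real \<Rightarrow> real) \<Rightarrow> (real \<times> real \<Rightarrow> real) \<Rightarrow> (real \<times> real \<Rightarrow> real)" where
  "conjugate h T = (\<lambda>(a, b). h (T (inv_into {0..1} h a, inv_into {0..1} h b)))"

text \<open>
  The pushforward is the library's \<^const>\<open>filtermap\<close>: with preimages taken in \<open>X\<close>, its members are
  those of the pushforward ultrafilter, and it is again an ultrafilter.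
\<close>

lemma mem_filtermap_iff:
  assumes "ultrafilter_on X U"
  shows "(\<forall>\<^sub>F y in filtermap h U. y \<in> B) \<longleftrightarrow> (\<forall>\<^sub>F x in U. x \<in> {x \<in> X. h x \<in> B})"
proof -
  have "\<forall>\<^sub>F x in U. x \<in> X"
    using assms by (simp add: ultrafilter_on_def le_principal)
  then show ?thesis
    by (simp add: eventually_filtermap eventually_conj_iff)
qed

lemma ultrafilter_on_filtermap:
  assumes U: "ultrafilter_on X U" and h: "h ` X \<subseteq> Y"
  shows "ultrafilter_on Y (filtermap h U)"
proof -
  have X: "\<forall>\<^sub>F x in U. x \<in> X"
    using U by (simp add: ultrafilter_on_def le_principal)
  have "(\<forall>\<^sub>F x in U. h x \<in> B) \<or> (\<forall>\<^sub>F x in U. h x \<in> Y - B)" for B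
  proof -
    have "\<forall>A\<subseteq>X. (\<forall>\<^sub>F x in U. x \<in> A) \<or> (\<forall>\<^sub>F x in U. x \<in> X - A)"
      using U unfolding ultrafilter_on_def by (elim conjE)
    moreover have "{x \<in> X. h x \<in> B} \<subseteq> X"
      by (rule Collect_restrict)
    ultimately have "(\<forall>\<^sub>F x in U. x \<in> {x \<in> X. h x \<in> B}) \<or>
        (\<forall>\<^sub>F x in U. x \<in> X - {x \<in> X. h x \<in> B})"
      by (elim allE impE)
    then show ?thesis
    proof
      assume "\<forall>\<^sub>F x in U. x \<in> {x \<in> X. h x \<in> B}"
      then have "\<forall>\<^sub>F x in U. h x \<in> B"
        by (rule eventually_mono) simp
      then show ?thesis ..
    next
      assume "\<forall>\<^sub>F x in U. x \<in> X - {x \<in> X. h x \<in> B}"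
      then have "\<forall>\<^sub>F x in U. h x \<in> Y - B"
        by (rule eventually_mono) (use h in blast)
      then show ?thesis ..
    qed
  qed
  moreover have "\<forall>\<^sub>F x in U. h x \<in> Y"
    using X by (rule eventually_mono) (use h in blast)
  moreover have "filtermap h U \<noteq> bot"
    using U by (simp add: ultrafilter_on_def filtermap_bot_iff)
  ultimately show ?thesis
    unfolding ultrafilter_on_def le_principal eventually_filtermap by blast
qed

end

theory Submission
  imports Defs
begin

text \<open>
  Conjugation by \<open>h\<close> is transport of structure: on points \<open>h x\<close>, \<open>h y\<close> the conjugate operation
  takes the value \<open>h (T (x, y))\<close>, so an agreement set \<open>A\<close> for \<open>S\<close> and \<open>T\<close> is carried to the
  agreement set \<open>h ` A\<close> for their conjugates. The image \<open>h ` A\<close> belongs to the pushforward because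
  its preimage contains \<open>A\<close>.
\<close>

lemma conjugate_image:
  assumes "inj_on h {0..1}" and "x \<in> {0..1}" and "y \<in> {0..1}"
  shows "conjugate h T (h x, h y) = h (T (x, y))"
  using assms by (simp add: conjugate_def inv_into_f_f)

lemma sim_mod_conjugate:
  assumes inj: "inj_on h {0..1}" and h: "h ` {0..1} \<subseteq> {0..1}" and "sim_mod W S T"
  shows "sim_mod (filtermap h W) (conjugate h S) (conjugate h T)"
proof -
  obtain A where A: "A \<subseteq> {0..1}" and ev: "\<forall>\<^sub>F x in W. x \<in> A"
    and eq: "\<And>x y. x \<in> A \<Longrightarrow> y \<in> A \<Longrightarrow> S (x, y) = T (x, y)"
    using assms(3) unfolding sim_mod_def by blast
  have "h ` A \<subseteq> {0..1}"
    using A h by blast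
  moreover have "\<forall>\<^sub>F y in filtermap h W. y \<in> h ` A"
    unfolding eventually_filtermap using ev by (rule eventually_mono) (rule imageI)
  moreover have "conjugate h S (h x, h y) = conjugate h T (h x, h y)"
    if "x \<in> A" "y \<in> A" for x y
  proof -
    have "x \<in> {0..1}" "y \<in> {0..1}"
      using that A by blast+
    then show ?thesis
      by (simp only: conjugate_image[OF inj] eq[OF that])
  qed
  ultimately show ?thesis
    unfolding sim_mod_def by (intro exI[of _ "h ` A"]) auto
qed

theorem proposition6p3:
  fixes U :: "real filter"
    and h :: "real \<Rightarrow> real"
    and S T :: "real \<times> real \<Rightarrow> real"
  assumes "ultrafilter_on {0..1} U"
    and "\<exists>g. homeomorphism {0..1} {0..1} h g"
    and "strict_mono_on {0..1} h"
    and "h 0 = 0"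
    and "h 1 = 1"
    and "S \<in> {0..1} \<times> {0..1} \<rightarrow> {0..1}"
    and "T \<in> {0..1} \<times> {0..1} \<rightarrow> {0..1}"
    and "sim_mod U S T"
  shows "sim_mod (filtermap h U) (conjugate h S) (conjugate h T)"
proof (rule sim_mod_conjugate)
  show "inj_on h {0..1}"
    using assms(3) by (rule strict_mono_on_imp_inj_on)
  show "h ` {0..1} \<subseteq> {0..1}"
    using assms(2) by (auto simp: homeomorphism_def)
  show "sim_mod U S T"
    by (rule assms(8))
qed

end
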